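(* Let $p$ be a prime. If $f\in\mathbb{Q}[x]$ is not $p$-type but is eventually $p$-type, then $f(x)=ax^{p^m}+ph(x)+b$ for some integer $m\ge1$, some $a,b\in\mathbb{Q}$ with $\nu_p(a)=\nu_p(b)=0$, and some $h\in\mathbb{Q}[x]$ with $\deg(h)<p^m$ and $\nu_p(h)\ge0$.
   Context: $\nu_p$ denotes the $p$-adic valuation on $\mathbb{Q}$ (with $\nu_p(0)=\infty$); for $h=\sum h_ix^i\in\mathbb{Q}[x]$, $\nu_p(h)=\min_i\nu_p(h_i)$ (Gaussian valuation). A polynomial $f(x)=a_dx^d+\dots+a_0\in\mathbb{Q}[x]$ of degree $d$ is $p$-type if $\nu_p(a_d)=0$ and $\nu_p(a_i)\ge1$ for all $0\le i\le d-1$. $f$ is eventually $p$-type if the $n$-fold composition $f^n$ is $p$-type for some $n\ge1$.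
   Formalization: The formal theorem adds the hypothesis deg(f) ≠ 1: for linear f the claim fails, e.g. p = 2 and f = x+1 is not 2-type, f² = x+2 is 2-type, but f does not have degree 2^m with m ≥ 1. *)

theory Defs
  imports
    "HOL-Computational_Algebra.Computational_Algebra"
    "HOL-Library.Extended"
begin

definition padic_val :: "nat \<Rightarrow> rat \<Rightarrow> int extended" where
  "padic_val p q =
     (if q = 0 then \<infinity>
      else Fin (int (multiplicity (int p) (fst (quotient_of q)))
                - int (multiplicity (int p) (snd (quotient_of q)))))"

text \<open>Coefficients beyond the degree are 0 and have valuation \<open>\<infinity>\<close>, so the minimum over
  all indices is the minimum over \<open>{..degree h}\<close>; in particular the zero polynomial gets \<open>\<infinity>\<close>.\<close>
definition gauss_val :: "nat \<Rightarrow> rat poly \<Rightarrow> int extended" where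
  "gauss_val p h = Min ((\<lambda>i. padic_val p (coeff h i)) ` {..degree h})"

definition p_type :: "nat \<Rightarrow> rat poly \<Rightarrow> bool" where
  "p_type p f \<longleftrightarrow>
     padic_val p (coeff f (degree f)) = 0 \<and> (\<forall>i<degree f. padic_val p (coeff f i) \<ge> 1)"

definition poly_iter :: "'a::comm_semiring_1 poly \<Rightarrow> nat \<Rightarrow> 'a poly" where
  "poly_iter f n = (pcompose f ^^ n) [:0, 1:]"

definition eventually_p_type :: "nat \<Rightarrow> rat poly \<Rightarrow> bool" where
  "eventually_p_type p f \<longleftrightarrow> (\<exists>n\<ge>1. p_type p (poly_iter f n))"

text \<open>Linear polynomials have to be excluded from the classification of polynomials that are
  eventually \<open>p\<close>-type but not \<open>p\<close>-type: \<open>x + 1\<close> is not \<open>2\<close>-type, its second iterate \<open>x + 2\<close> is,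
  and \<open>x + 1\<close> does not have degree \<open>2 ^ m\<close> with \<open>m \<ge> 1\<close>.\<close>
lemma linear_counterexample:
  "\<not> p_type 2 [:1, 1:]" "eventually_p_type 2 [:1, 1:]"
  "\<not> (\<exists>m\<ge>1. \<exists>a b h. padic_val 2 a = 0 \<and> degree h < 2 ^ m \<and>
        [:1, 1:] = monom a (2 ^ m) + smult (of_nat 2) h + [:b:])"
proof -
  have v1: "padic_val 2 1 = 0"
    by (simp add: padic_val_def zero_extended_def)
  have v2: "padic_val 2 2 = 1"
  proof -
    have "quotient_of 2 = (2, 1)"
      using quotient_of_int[of 2] by (simp add: of_int_def)
    then show ?thesis
      by (simp add: padic_val_def one_extended_def)
  qed
  show "\<not> p_type 2 [:1, 1:]"
    by (simp add: p_type_def v1 zero_extended_def one_extended_def)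
  have "poly_iter [:1, 1:] 2 = [:2, 1 :: rat:]"
    by (simp add: poly_iter_def numeral_2_eq_2 pcompose_pCons)
  then have "p_type 2 (poly_iter [:1, 1:] 2)"
    by (simp add: p_type_def v1 v2)
  then show "eventually_p_type 2 [:1, 1:]"
    unfolding eventually_p_type_def by (intro exI[of _ 2]) simp
  show "\<not> (\<exists>m\<ge>1. \<exists>a b h. padic_val 2 a = 0 \<and> degree h < 2 ^ m \<and>
        [:1, 1:] = monom a (2 ^ m) + smult (of_nat 2) h + [:b:])"
  proof (intro notI, elim exE conjE)
    fix m :: nat and a b h
    assume m: "1 \<le> m" and a: "padic_val 2 a = 0" and h: "degree h < 2 ^ m"
      and eq: "[:1, 1:] = monom a (2 ^ m) + smult (of_nat 2) h + [:b:]"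
    have gt: "(1::nat) < 2 ^ m" using m by (intro one_less_power) auto
    have c: "coeff [:c, d:] (2 ^ m) = 0" for c d :: rat
      using gt by (intro coeff_eq_0) (simp add: le_less_trans[OF degree_pCons_le])
    have "coeff [:b:] (2 ^ m) = 0" using gt by (intro coeff_eq_0) simp
    moreover have "coeff h (2 ^ m) = 0" using h by (rule coeff_eq_0)
    moreover note arg_cong[OF eq, of "\<lambda>q. coeff q (2 ^ m)"] c[of 1 1]
    ultimately have "a = 0" by simp
    with a show False by (simp add: padic_val_def zero_extended_def)
  qed
qed

end

theory Submission
  imports Defs "HOL-Algebra.Exponent"
begin

text \<open>Track the first index at which the (weighted) Gaussian valuation of a polynomial is attained.
  If \<open>g(0) = 0\<close> this index is positive, and under composition \<open>f \<circ> g\<close> these indices multiply.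
  A polynomial is \<open>p\<close>-type iff its first index is its degree and its Gaussian valuation is \<open>0\<close>; so
  if \<open>f \<circ> g\<close> is \<open>p\<close>-type, then so are \<open>g - g(0)\<close> and \<open>f(x + g(0))\<close>.

  Reading the \<open>p\<close>-type iterate as \<open>f\<^sup>n \<circ> f\<close> shows that \<open>f - b\<close> is \<open>p\<close>-type, where \<open>b = f(0)\<close>. If \<open>b\<close>
  had negative valuation, the orbit of \<open>0\<close> would escape to infinity \<open>p\<close>-adically; if it had positive
  valuation, \<open>f\<close> would be \<open>p\<close>-type. So \<open>b\<close> is a unit. Reading the iterate as \<open>f \<circ> f\<^sup>n\<close> shows that
  \<open>f(x + y)\<close> is \<open>p\<close>-type for \<open>y = f\<^sup>n(0)\<close>, which is a unit. Hence \<open>u(x - y)\<^sup>d\<close> and \<open>u x\<^sup>d + b\<close> agree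
  modulo \<open>p\<close>, so \<open>p\<close> divides all inner binomial coefficients of \<open>d\<close>, i.e. \<open>d\<close> is a power of \<open>p\<close>.\<close>

section \<open>Valuation bounds and first minima\<close>

definition val_ge :: "nat \<Rightarrow> int \<Rightarrow> rat \<Rightarrow> bool" where
  "val_ge p k x \<longleftrightarrow> Fin k \<le> padic_val p x"

text \<open>Phrased through two lower bounds, so that lower bounds alone settle exact valuations; 0,
  which satisfies every \<open>val_ge\<close>, has no exact valuation.\<close>

definition val_eq :: "nat \<Rightarrow> int \<Rightarrow> rat \<Rightarrow> bool" where
  "val_eq p k x \<longleftrightarrow> val_ge p k x \<and> \<not> val_ge p (k + 1) x"

text \<open>For prime \<open>p\<close>, \<open>w\<close> is the Gaussian valuation of
  \<open>h\<close>, and \<open>j\<close> is the order of vanishing at 0 of the reduction modulo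
  \<open>p\<close> of \<open>h\<close> divided by \<open>p ^ w\<close>.\<close>

definition first_min :: "nat \<Rightarrow> int \<Rightarrow> nat \<Rightarrow> rat poly \<Rightarrow> bool" where
  "first_min p w j h \<longleftrightarrow> (\<forall>i. val_ge p w (coeff h i)) \<and> val_eq p w (coeff h j) \<and>
     (\<forall>i<j. val_ge p (w + 1) (coeff h i))"

lemma padic_val_eq_iff: "padic_val p x = Fin k \<longleftrightarrow> val_eq p k x"
  by (auto simp: val_eq_def val_ge_def padic_val_def)

lemma val_ge_0 [simp]: "val_ge p k 0"
  by (simp add: val_ge_def padic_val_def)

lemma val_ge_mono: "val_ge p k x \<Longrightarrow> l \<le> k \<Longrightarrow> val_ge p l x"
  by (auto simp: val_ge_def padic_val_def)

lemma val_eq_unique: "val_eq p k x \<Longrightarrow> val_eq p l x \<Longrightarrow> k = l"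
  unfolding padic_val_eq_iff[symmetric] by simp

lemma val_eq_nonzero: "val_eq p k x \<Longrightarrow> x \<noteq> 0"
  by (auto simp: val_eq_def)

lemma val_eq_exists: "x \<noteq> 0 \<Longrightarrow> \<exists>k. val_eq p k x"
  unfolding padic_val_eq_iff[symmetric] by (simp add: padic_val_def)

lemma p_type_iff_first_min: "p_type p f \<longleftrightarrow> first_min p 0 (degree f) f"
proof
  assume f: "p_type p f"
  have 1: "val_ge p 1 (coeff f i)" if "i < degree f" for i
    using f that by (simp add: p_type_def val_ge_def one_extended_def)
  have eq: "val_eq p 0 (coeff f (degree f))"
    using f by (simp add: p_type_def padic_val_eq_iff[symmetric] zero_extended_def)
  have "val_ge p 0 (coeff f i)" for i
  proof (cases i "degree f" rule: linorder_cases)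
    case less
    then show ?thesis using 1 val_ge_mono by fastforce
  next
    case equal
    then show ?thesis using eq by (simp add: val_eq_def)
  next
    case greater
    then show ?thesis by (simp add: coeff_eq_0)
  qed
  with 1 eq show "first_min p 0 (degree f) f"
    by (simp add: first_min_def)
next
  assume "first_min p 0 (degree f) f"
  then show "p_type p f"
    by (simp add: first_min_def p_type_def val_ge_def one_extended_def zero_extended_def
        padic_val_eq_iff)
qed

lemma first_min_unique:
  assumes "first_min p w j h" "first_min p w' j' h"
  shows "w = w'" "j = j'"
proof -
  have "\<not> w < w'" if "first_min p w j h" "first_min p w' j' h" for w w' j j'
    using that val_ge_mono[of p w' _ "w + 1"] by (auto simp: first_min_def val_eq_def)
  with assms show "w = w'" by (meson linorder_less_linear)
  with assms show "j = j'"
    by (metis first_min_def linorder_neqE_nat val_eq_def)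
qed

lemma first_min_le_degree: "first_min p w j h \<Longrightarrow> j \<le> degree h"
  unfolding first_min_def using le_degree val_eq_nonzero by blast

lemma gauss_val_ge_iff: "gauss_val p h \<ge> Fin k \<longleftrightarrow> (\<forall>i. val_ge p k (coeff h i))"
proof -
  have "gauss_val p h \<ge> Fin k \<longleftrightarrow> (\<forall>i\<le>degree h. val_ge p k (coeff h i))"
    by (simp add: gauss_val_def val_ge_def) blast
  also have "\<dots> \<longleftrightarrow> (\<forall>i. val_ge p k (coeff h i))"
    by (metis coeff_eq_0 not_le val_ge_0)
  finally show ?thesis .
qed

section \<open>Arithmetic of the p-adic valuation\<close>

lemma padic_val_fraction:
  assumes p: "prime p" and ab: "a \<noteq> 0" "b \<noteq> 0"
  shows "padic_val p (of_int a / of_int b) =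
           Fin (int (multiplicity (int p) a) - int (multiplicity (int p) b))"
proof -
  obtain n d where nd: "quotient_of (of_int a / of_int b) = (n, d)" by fastforce
  have d: "d > 0" using quotient_of_denom_pos[OF nd] .
  have eq: "(of_int a / of_int b :: rat) = of_int n / of_int d"
    using quotient_of_div[OF nd] .
  \<comment> \<open>Cross-multiplying gives an identity of integers, so additivity of
    \<open>multiplicity\<close> makes the valuation independent of the chosen fraction.\<close>
  then have "(of_int (a * d) :: rat) = of_int (n * b)"
    using ab d by (simp add: field_simps)
  then have ad: "a * d = n * b" by (simp only: of_int_eq_iff)
  have n: "n \<noteq> 0" using ad ab d by auto
  have pe: "prime_elem (int p)" using p by simp
  have "multiplicity (int p) a + multiplicity (int p) d =
        multiplicity (int p) n + multiplicity (int p) b"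
    using prime_elem_multiplicity_mult_distrib[OF pe, of a d]
      prime_elem_multiplicity_mult_distrib[OF pe, of n b] ad ab n d by simp
  then show ?thesis
    using nd ab by (simp add: padic_val_def)
qed

lemma val_eq_mult:
  assumes p: "prime p" and "val_eq p k x" "val_eq p l y"
  shows "val_eq p (k + l) (x * y)"
proof -
  obtain a b where x: "x = of_int a / of_int b" "b > 0"
    using quotient_of_div quotient_of_denom_pos by (metis surj_pair)
  obtain c d where y: "y = of_int c / of_int d" "d > 0"
    using quotient_of_div quotient_of_denom_pos by (metis surj_pair)
  have nz: "a \<noteq> 0" "c \<noteq> 0" "b \<noteq> 0" "d \<noteq> 0"
    using val_eq_nonzero[OF assms(2)] val_eq_nonzero[OF assms(3)] x y by auto
  have pe: "prime_elem (int p)" using p by simp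
  have xy: "x * y = of_int (a * c) / of_int (b * d)" using x y by simp
  show ?thesis
    using assms(2,3) nz unfolding padic_val_eq_iff[symmetric] xy
    using x(1) y(1) padic_val_fraction[OF p, of "a * c" "b * d"]
    by (simp add: padic_val_fraction[OF p] prime_elem_multiplicity_mult_distrib[OF pe])
qed

lemma val_ge_mult:
  assumes p: "prime p" and "val_ge p k x" "val_ge p l y"
  shows "val_ge p (k + l) (x * y)"
proof (cases "x = 0 \<or> y = 0")
  case False
  then obtain k' l' where kl: "val_eq p k' x" "val_eq p l' y"
    using val_eq_exists by meson
  then have "k \<le> k'" "l \<le> l'"
    using assms(2,3) by (auto simp: padic_val_eq_iff[symmetric] val_ge_def)
  moreover have "val_ge p (k' + l') (x * y)"
    using val_eq_mult[OF p kl] by (simp add: val_eq_def)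
  ultimately show ?thesis using val_ge_mono by fastforce
qed auto

lemma val_ge_add:
  assumes p: "prime p" and xy: "val_ge p k x" "val_ge p k y"
  shows "val_ge p k (x + y)"
proof (cases "x = 0 \<or> y = 0 \<or> x + y = 0")
  case True
  then show ?thesis using xy by auto
next
  case False
  obtain a b where x: "x = of_int a / of_int b" "b > 0"
    using quotient_of_div quotient_of_denom_pos by (metis surj_pair)
  obtain c d where y: "y = of_int c / of_int d" "d > 0"
    using quotient_of_div quotient_of_denom_pos by (metis surj_pair)
  \<comment> \<open>Over a common denominator the ultrametric inequality reduces to divisibility of
    \<open>A + B\<close> by a power of \<open>p\<close>.\<close>
  define A B N where "A = a * d" and "B = c * b" and "N = b * d"
  have eqs: "x = of_int A / of_int N" "y = of_int B / of_int N" "x + y = of_int (A + B) / of_int N"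
    using x y by (simp_all add: A_def B_def N_def field_simps)
  have nz: "A \<noteq> 0" "B \<noteq> 0" "A + B \<noteq> 0" "N \<noteq> 0"
    using False eqs by auto
  let ?m = "multiplicity (int p)"
  have "int p ^ min (?m A) (?m B) dvd A + B"
    by (intro dvd_add multiplicity_dvd') auto
  moreover have "\<not> is_unit (int p)" using p by auto
  ultimately have "min (?m A) (?m B) \<le> ?m (A + B)"
    using nz by (intro multiplicity_geI) auto
  moreover have "k \<le> int (?m A) - int (?m N)" "k \<le> int (?m B) - int (?m N)"
    using xy nz by (simp_all add: eqs(1,2) val_ge_def padic_val_fraction[OF p])
  ultimately have "k \<le> int (?m (A + B)) - int (?m N)" by linarith
  then show ?thesis
    unfolding eqs(3) val_ge_def padic_val_fraction[OF p nz(3,4)] by simp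
qed

lemma val_ge_minus [simp]: "val_ge p k (- x) \<longleftrightarrow> val_ge p k x"
proof -
  have "padic_val p (- x) = padic_val p x"
    by (auto simp: padic_val_def rat_uminus_code split: prod.split)
  then show ?thesis by (simp add: val_ge_def)
qed

lemma val_eq_minus [simp]: "val_eq p k (- x) \<longleftrightarrow> val_eq p k x"
  by (simp add: val_eq_def)

lemma val_ge_diff:
  "prime p \<Longrightarrow> val_ge p k x \<Longrightarrow> val_ge p k y \<Longrightarrow> val_ge p k (x - y)"
  using val_ge_add[of p k x "- y"] by simp

lemma val_ge_sum:
  "prime p \<Longrightarrow> (\<And>i. i \<in> A \<Longrightarrow> val_ge p k (g i)) \<Longrightarrow> val_ge p k (sum g A)"
  by (induction A rule: infinite_finite_induct) (auto intro: val_ge_add)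

text \<open>A term of higher valuation cannot disturb \<open>x\<close>: a bound \<open>k + 1\<close>
  on \<open>x + y\<close> would pass to \<open>x = (x + y) - y\<close>.\<close>

lemma val_eq_add:
  assumes p: "prime p" and "val_eq p k x" "val_ge p (k + 1) y"
  shows "val_eq p k (x + y)"
  using assms val_ge_add[OF p, of k x y] val_ge_diff[OF p, of "k + 1" "x + y" y]
    val_ge_mono[of p "k + 1" y k] by (auto simp: val_eq_def)

lemma val_eq_of_int: "prime p \<Longrightarrow> \<not> int p dvd a \<Longrightarrow> val_eq p 0 (of_int a)"
  using padic_val_fraction[of p a 1]
  by (auto simp: padic_val_eq_iff[symmetric] not_dvd_imp_multiplicity_0)

lemma val_eq_1: "prime p \<Longrightarrow> val_eq p 0 1"
  using val_eq_of_int[of p 1] not_prime_1 by fastforce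

lemma val_eq_power:
  "prime p \<Longrightarrow> val_eq p k x \<Longrightarrow> val_eq p (int n * k) (x ^ n)"
proof (induction n)
  case (Suc n)
  then show ?case
    using val_eq_mult[of p k x "int n * k" "x ^ n"] by (simp add: algebra_simps)
qed (simp add: val_eq_1)

lemma val_ge_power:
  "prime p \<Longrightarrow> val_ge p k x \<Longrightarrow> val_ge p (int n * k) (x ^ n)"
proof (induction n)
  case (Suc n)
  then show ?case
    using val_ge_mult[of p k x "int n * k" "x ^ n"] by (simp add: algebra_simps)
qed (use val_eq_1 in \<open>auto simp: val_eq_def\<close>)

section \<open>First minima of products and compositions\<close>

lemma first_min_mult:
  assumes p: "prime p" and g: "first_min p w j g" and h: "first_min p v l h"
  shows "first_min p (w + v) (j + l) (g * h)"
proof -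
  have gge: "val_ge p w (coeff g i)" and hge: "val_ge p v (coeff h i)" for i
    using g h by (auto simp: first_min_def)
  have small: "val_ge p (w + v + 1) (coeff g i * coeff h i')" if "i < j \<or> i' < l" for i i'
    using that
  proof
    assume "i < j"
    then have "val_ge p (w + 1) (coeff g i)" using g by (simp add: first_min_def)
    from val_ge_mult[OF p this hge[of i']] show ?thesis by (simp add: algebra_simps)
  next
    assume "i' < l"
    then have "val_ge p (v + 1) (coeff h i')" using h by (simp add: first_min_def)
    from val_ge_mult[OF p gge[of i] this] show ?thesis by (simp add: algebra_simps)
  qed
  have "val_ge p (w + v) (coeff (g * h) n)" for n
    unfolding coeff_mult using p by (intro val_ge_sum val_ge_mult gge hge)
  moreover have "val_ge p (w + v + 1) (coeff (g * h) n)" if "n < j + l" for n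
    unfolding coeff_mult using p that by (intro val_ge_sum small) auto
  moreover have "val_eq p (w + v) (coeff (g * h) (j + l))"
  proof -
    \<comment> \<open>Every other pair of indices with sum \<open>j + l\<close> has its first member
      below \<open>j\<close> or its second below \<open>l\<close>, so no other term competes with
      this one.\<close>
    have "coeff (g * h) (j + l) = coeff g j * coeff h l +
            (\<Sum>i\<in>{..j + l} - {j}. coeff g i * coeff h (j + l - i))"
      unfolding coeff_mult by (subst sum.remove[of _ j]) auto
    moreover have "val_ge p (w + v + 1) (\<Sum>i\<in>{..j + l} - {j}. coeff g i * coeff h (j + l - i))"
      using p by (intro val_ge_sum small) auto
    moreover have "val_eq p (w + v) (coeff g j * coeff h l)"
      using p g h by (intro val_eq_mult) (auto simp: first_min_def)
    ultimately show ?thesis using val_eq_add[OF p] by simp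
  qed
  ultimately show ?thesis by (simp add: first_min_def)
qed

lemma first_min_power:
  assumes p: "prime p" and g: "first_min p w j g"
  shows "first_min p (int n * w) (n * j) (g ^ n)"
proof (induction n)
  case 0
  show ?case using val_eq_1[OF p]
    by (auto simp: first_min_def val_eq_def)
next
  case (Suc n)
  show ?case using first_min_mult[OF p g Suc] by (simp add: algebra_simps)
qed

lemma pcompose_conv_sum:
  "pcompose f g = (\<Sum>i\<le>degree f. smult (coeff f i) (g ^ i))" for f g :: "'a::comm_ring_1 poly"
  by (induction f rule: pCons_induct)
    (auto simp: pcompose_pCons degree_pCons_eq_if sum.atMost_Suc_shift sum_distrib_left
      simp del: sum.atMost_Suc)

text \<open>The coefficient of index \<open>i\<close> of \<open>f\<close> carries the weight \<open>i * w\<close>, the Gaussian valuation of \<open>g ^ i\<close>.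
  Positivity of \<open>j\<close> rules out cancellation: the terms with \<open>i > k\<close> have their first minimum at
  \<open>i * j > k * j\<close>.\<close>
lemma first_min_pcompose:
  assumes p: "prime p" and g: "first_min p w j g" and j: "j > 0"
    and ge: "\<And>i. val_ge p (W - int i * w) (coeff f i)"
    and eq: "val_eq p (W - int k * w) (coeff f k)"
    and less: "\<And>i. i < k \<Longrightarrow> val_ge p (W - int i * w + 1) (coeff f i)"
  shows "first_min p W (k * j) (pcompose f g)"
proof -
  have pw: "first_min p (int i * w) (i * j) (g ^ i)" for i
    using first_min_power[OF p g] .
  have t: "val_ge p W (coeff f i * coeff (g ^ i) n)" for i n
  proof -
    have "val_ge p (int i * w) (coeff (g ^ i) n)" using pw[of i] by (simp add: first_min_def)
    from val_ge_mult[OF p ge[of i] this] show ?thesis by simp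
  qed
  \<comment> \<open>One unit of valuation is gained from \<open>f\<close> when \<open>i < k\<close>,
    and from \<open>g ^ i\<close> when \<open>n < i * j\<close>.\<close>
  have t1: "val_ge p (W + 1) (coeff f i * coeff (g ^ i) n)" if "i < k \<or> n < i * j" for i n
    using that
  proof
    assume "i < k"
    moreover have "val_ge p (int i * w) (coeff (g ^ i) n)" using pw[of i] by (simp add: first_min_def)
    ultimately show ?thesis using val_ge_mult[OF p less[of i]] by fastforce
  next
    assume "n < i * j"
    then have "val_ge p (int i * w + 1) (coeff (g ^ i) n)" using pw[of i] by (simp add: first_min_def)
    from val_ge_mult[OF p ge[of i] this] show ?thesis by simp
  qed
  have k: "k \<le> degree f" using eq val_eq_nonzero le_degree by blast
  have co: "coeff (pcompose f g) n = (\<Sum>i\<le>degree f. coeff f i * coeff (g ^ i) n)" for n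
    by (simp add: pcompose_conv_sum coeff_sum)
  have "val_ge p W (coeff (pcompose f g) n)" for n
    unfolding co using p by (intro val_ge_sum t)
  moreover have "val_ge p (W + 1) (coeff (pcompose f g) n)" if "n < k * j" for n
  proof -
    have "i < k \<or> n < i * j" for i
      using that j by (metis le_less_trans less_le_trans mult_le_mono1 not_le)
    then show ?thesis unfolding co using p by (intro val_ge_sum t1)
  qed
  moreover have "val_eq p W (coeff (pcompose f g) (k * j))"
  proof -
    have "coeff (pcompose f g) (k * j) = coeff f k * coeff (g ^ k) (k * j) +
            (\<Sum>i\<in>{..degree f} - {k}. coeff f i * coeff (g ^ i) (k * j))"
      unfolding co using k by (subst sum.remove[of _ k]) auto
    moreover have "val_ge p (W + 1) (\<Sum>i\<in>{..degree f} - {k}. coeff f i * coeff (g ^ i) (k * j))"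
      using p j by (intro val_ge_sum t1) auto
    moreover have "val_eq p W (coeff f k * coeff (g ^ k) (k * j))"
      using val_eq_mult[OF p eq, of "int k * w" "coeff (g ^ k) (k * j)"] pw[of k]
      by (simp add: first_min_def)
    ultimately show ?thesis using val_eq_add[OF p] by simp
  qed
  ultimately show ?thesis by (simp add: first_min_def)
qed

text \<open>On the finite support of \<open>f\<close> the weighted valuations are integers;
  \<open>W\<close> is their minimum and \<open>k\<close> the first index attaining it. Weight 0
  gives an ordinary first minimum.\<close>

lemma weighted_first_min_exists:
  assumes "f \<noteq> 0"
  obtains W k where "\<And>i. val_ge p (W - int i * w) (coeff f i)"
    "val_eq p (W - int k * w) (coeff f k)"
    "\<And>i. i < k \<Longrightarrow> val_ge p (W - int i * w + 1) (coeff f i)"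
proof -
  define I where "I = {i. coeff f i \<noteq> 0}"
  have fin: "finite I"
    by (rule finite_subset[of _ "{..degree f}"]) (auto simp: I_def intro: le_degree)
  have ne: "I \<noteq> {}" using assms by (auto simp: I_def poly_eq_iff)
  have "\<forall>i\<in>I. \<exists>v. val_eq p v (coeff f i)"
    using val_eq_exists by (simp add: I_def)
  then obtain u where "\<forall>i\<in>I. val_eq p (u i) (coeff f i)"
    unfolding bchoice_iff by blast
  then have u: "val_eq p (u i) (coeff f i)" if "i \<in> I" for i using that by blast
  define V where "V i = u i + int i * w" for i
  define W where "W = Min (V ` I)"
  define k where "k = (LEAST i. i \<in> I \<and> V i = W)"
  have ge: "W \<le> V i" if "i \<in> I" for i
    unfolding W_def using fin that by simp
  have "W \<in> V ` I" unfolding W_def using fin ne by (intro Min_in) auto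
  then have "\<exists>i. i \<in> I \<and> V i = W" by auto
  then have k: "k \<in> I" "V k = W" unfolding k_def by (metis (mono_tags, lifting) LeastI_ex)+
  show thesis
  proof (rule that[of W k])
    show "val_ge p (W - int i * w) (coeff f i)" for i
    proof (cases "i \<in> I")
      case True
      then show ?thesis
        using u[OF True] ge[OF True] val_ge_mono[of p "u i"] by (simp add: V_def val_eq_def)
    qed (simp add: I_def)
    have "u k = W - int k * w" using k(2) by (simp add: V_def)
    then show "val_eq p (W - int k * w) (coeff f k)" using u[OF k(1)] by simp
    show "val_ge p (W - int i * w + 1) (coeff f i)" if "i < k" for i
    proof (cases "i \<in> I")
      case True
      have "V i \<noteq> W" using not_less_Least[OF that[unfolded k_def]] True by blast
      then have "W < V i" using ge[OF True] by simp
      then show ?thesis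
        using u[OF True] val_ge_mono[of p "u i"] by (simp add: V_def val_eq_def)
    qed (simp add: I_def)
  qed
qed

section \<open>Factors of a p-type composition\<close>

lemma degree_diff_const:
  "degree f > 0 \<Longrightarrow> degree (f - [:c:]) = degree f" for f :: "'a::ab_group_add poly"
  using degree_add_eq_left[of "[:- c:]" f]
  by (simp add: diff_conv_add_uminus del: add_uminus_conv_diff)

text \<open>The index \<open>k * j\<close> is at most \<open>degree f * degree g\<close>, and a
  \<open>p\<close>-type composition attains this bound, so both factors are extremal. The unit
  leading coefficient of \<open>g\<close> excludes rescalings such as \<open>x / p\<close> composed
  with \<open>p x\<close>.\<close>

lemma p_type_pcompose_factors:
  assumes p: "prime p" and fg: "p_type p (pcompose f g)"
    and df: "degree f > 0" and dg: "degree g > 0" and g: "val_eq p 0 (lead_coeff g)"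
  shows "p_type p (g - [:coeff g 0:])" "p_type p (pcompose f [:coeff g 0, 1:])"
proof -
  define h where "h = g - [:coeff g 0:]"
  define F where "F = pcompose f [:coeff g 0, 1:]"
  have dh: "degree h = degree g"
    using dg unfolding h_def by (rule degree_diff_const)
  have lh: "coeff h (degree g) = lead_coeff g"
    using dg by (simp add: h_def coeff_pCons split: nat.split)
  have dF: "degree F = degree f" by (simp add: F_def degree_pcompose)
  \<comment> \<open>The shift by \<open>g(0)\<close> moves from the inner to the outer polynomial.
    It serves to make \<open>j\<close> positive, as \<open>h\<close> has no constant term.\<close>
  have comp: "pcompose F h = pcompose f g"
    by (simp add: F_def h_def pcompose_assoc[symmetric] pcompose_pCons)
  have "h \<noteq> 0" using dh dg by auto
  then obtain w j where wj: "first_min p w j h"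
    using weighted_first_min_exists[of h p 0] unfolding first_min_def
    by (metis diff_zero mult_zero_right)
  have "coeff h 0 = 0" by (simp add: h_def)
  then have j: "j > 0"
    using wj val_eq_nonzero by (metis first_min_def gr0I)
  have "F \<noteq> 0" using dF df by auto
  then obtain W k where Wk: "\<And>i. val_ge p (W - int i * w) (coeff F i)"
    "val_eq p (W - int k * w) (coeff F k)"
    "\<And>i. i < k \<Longrightarrow> val_ge p (W - int i * w + 1) (coeff F i)"
    using weighted_first_min_exists[of F p w] by blast
  have fm: "first_min p W (k * j) (pcompose f g)"
    using first_min_pcompose[OF p wj j Wk] comp by simp
  have fg': "first_min p 0 (degree f * degree g) (pcompose f g)"
    using fg by (simp add: p_type_iff_first_min degree_pcompose)
  have W: "W = 0" and kj: "k * j = degree f * degree g"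
    using first_min_unique[OF fm fg'] by auto
  have le: "k \<le> degree f" "j \<le> degree g"
    using Wk(2) val_eq_nonzero le_degree dF first_min_le_degree[OF wj] dh by metis+
  have "\<not> k < degree f"
  proof
    assume "k < degree f"
    then have "k * j < degree f * degree g"
      using le j by (intro mult_less_le_imp_less) auto
    then show False using kj by simp
  qed
  then have k: "k = degree f" using le by simp
  then have jg: "j = degree g" using kj df by simp
  \<comment> \<open>Until now the weight \<open>w\<close> was unknown; once it is 0, the weighted
    minimum of \<open>F\<close> is an ordinary one.\<close>
  have "val_eq p w (lead_coeff g)" using wj jg lh by (simp add: first_min_def)
  then have w: "w = 0" using g val_eq_unique by blast
  show "p_type p (g - [:coeff g 0:])"
    using wj w jg dh by (simp add: p_type_iff_first_min h_def)
  have "first_min p 0 (degree F) F"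
    using Wk W w k dF by (simp add: first_min_def)
  then show "p_type p (pcompose f [:coeff g 0, 1:])"
    by (simp add: p_type_iff_first_min F_def)
qed

section \<open>Iterates and escaping orbits\<close>

lemma poly_iter_Suc: "poly_iter f (Suc n) = pcompose f (poly_iter f n)"
  by (simp add: poly_iter_def)

lemma poly_iter_Suc2:
  "poly_iter f (Suc n) = pcompose (poly_iter f n) f" for f :: "'a::comm_ring_1 poly"
proof (induction n)
  case 0
  show ?case by (simp add: poly_iter_def pcompose_pCons)
next
  case (Suc n)
  then show ?case by (metis poly_iter_Suc pcompose_assoc)
qed

lemma degree_poly_iter: "degree (poly_iter f n) = degree f ^ n" for f :: "rat poly"
  by (induction n) (simp_all add: poly_iter_Suc degree_pcompose, simp add: poly_iter_def)

lemma poly_poly_iter_Suc: "poly (poly_iter f (Suc n)) z = poly f (poly (poly_iter f n) z)"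
  for f :: "'a::comm_ring_1 poly"
  by (simp add: poly_iter_Suc poly_pcompose)

text \<open>The leading coefficient of an iterate is a power of \<open>a\<close>. Written as
  \<open>1 + N * degree f\<close>, the exponent is visibly positive, so valuation 0 of the power
  forces valuation 0 of \<open>a\<close>.\<close>

lemma val_eq_lead_coeff_poly_iterD:
  assumes p: "prime p" and d: "degree f > 0" and v: "val_eq p 0 (lead_coeff (poly_iter f (Suc n)))"
  shows "val_eq p 0 (lead_coeff f)"
proof -
  define a where "a = lead_coeff f"
  have "\<exists>N. lead_coeff (poly_iter f n) = a ^ N" for n
  proof (induction n)
    case 0
    show ?case by (auto simp: poly_iter_def intro: exI[of _ 0])
  next
    case (Suc n)
    then obtain N where "lead_coeff (poly_iter f n) = a ^ N" by blast
    then have "lead_coeff (poly_iter f (Suc n)) = a ^ (1 + N * degree f)"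
      using d by (simp add: poly_iter_Suc lead_coeff_comp degree_poly_iter a_def power_mult)
    then show ?case by blast
  qed
  then obtain N where "lead_coeff (poly_iter f n) = a ^ N" by blast
  then have lc: "lead_coeff (poly_iter f (Suc n)) = a ^ (1 + N * degree f)"
    using d by (simp add: poly_iter_Suc lead_coeff_comp degree_poly_iter a_def power_mult)
  have "a \<noteq> 0" using d by (auto simp: a_def)
  then obtain k where k: "val_eq p k a" using val_eq_exists by blast
  have "val_eq p (int (1 + N * degree f) * k) (a ^ (1 + N * degree f))"
    using val_eq_power[OF p k] .
  then have "int (1 + N * degree f) * k = 0"
    using v unfolding lc by (rule val_eq_unique)
  then have "k = 0" by (simp only: mult_eq_0_iff of_nat_eq_0_iff) simp
  with k show ?thesis by (simp add: a_def)
qed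

lemma val_ge_poly:
  assumes p: "prime p" and h: "\<And>i. val_ge p k (coeff h i)" and z: "val_ge p 0 z"
  shows "val_ge p k (poly h z)"
proof -
  have "val_ge p (k + int i * 0) (coeff h i * z ^ i)" for i
    by (intro val_ge_mult val_ge_power p h z)
  then show ?thesis by (simp add: poly_altdef val_ge_sum[OF p])
qed

text \<open>For \<open>c < 0\<close> higher powers of \<open>z\<close> have smaller valuation. Hence
  the top term, with its unit coefficient, dominates all others.\<close>

lemma p_type_escape:
  assumes p: "prime p" and g: "p_type p g" and z: "val_eq p c z" and c: "c < 0"
  shows "val_eq p (int (degree g) * c) (poly g z)"
proof -
  let ?d = "degree g"
  have g': "first_min p 0 ?d g" using g by (simp add: p_type_iff_first_min)
  have "poly g z = coeff g ?d * z ^ ?d + (\<Sum>i<?d. coeff g i * z ^ i)"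
    by (simp add: poly_altdef lessThan_Suc_atMost[symmetric])
  moreover have "val_eq p (0 + int ?d * c) (coeff g ?d * z ^ ?d)"
    using p g' z by (intro val_eq_mult val_eq_power) (auto simp: first_min_def)
  moreover have "val_ge p (int ?d * c + 1) (\<Sum>i<?d. coeff g i * z ^ i)"
  proof (intro val_ge_sum p)
    fix i assume "i \<in> {..<?d}"
    then have i: "i < ?d" by simp
    have "val_ge p (1 + int i * c) (coeff g i * z ^ i)"
      using p g' z i by (intro val_ge_mult val_ge_power) (auto simp: first_min_def val_eq_def)
    moreover have "int ?d * c \<le> int i * c" using i c by (simp add: mult_right_mono_neg)
    ultimately show "val_ge p (int ?d * c + 1) (coeff g i * z ^ i)"
      using val_ge_mono by fastforce
  qed
  ultimately show ?thesis using val_eq_add[OF p] by simp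
qed

text \<open>The orbit starts at \<open>b\<close>, of valuation \<open>c\<close>. Each further step
  multiplies the valuation by the degree, and adding \<open>b\<close> back does not
  interfere.\<close>

lemma poly_iter_escape:
  assumes p: "prime p" and g: "p_type p (f - [:b:])" and d: "degree f \<ge> 2"
    and b: "val_eq p c b" "b = coeff f 0" and c: "c < 0"
  shows "\<exists>e\<le>c. val_eq p e (poly (poly_iter f (Suc n)) 0)"
proof (induction n)
  case 0
  show ?case using b by (auto simp: poly_iter_Suc poly_iter_def poly_0_coeff_0)
next
  case (Suc n)
  define z where "z = poly (poly_iter f (Suc n)) 0"
  obtain e where e: "e \<le> c" "val_eq p e z" using Suc by (auto simp: z_def)
  have dg: "degree (f - [:b:]) = degree f"
    using d by (intro degree_diff_const) simp
  have "val_eq p (int (degree f) * e) (poly (f - [:b:]) z)"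
    using p_type_escape[OF p g e(2)] e c dg by simp
  moreover have "int (degree f) * e \<le> 2 * e"
    using d e c by (intro mult_right_mono_neg) auto
  \<comment> \<open>From \<open>e \<le> c \<le> -1\<close> already \<open>2 * e + 1 \<le> c\<close>;
    this is where degree at least 2 enters.\<close>
  then have le: "int (degree f) * e + 1 \<le> c" using e c by linarith
  then have "val_ge p (int (degree f) * e + 1) b"
    using b(1) val_ge_mono by (auto simp: val_eq_def)
  ultimately have "val_eq p (int (degree f) * e) (poly (f - [:b:]) z + b)"
    using val_eq_add[OF p] by blast
  then have "val_eq p (int (degree f) * e) (poly (poly_iter f (Suc (Suc n))) 0)"
    by (simp add: poly_poly_iter_Suc[of f "Suc n"] z_def)
  then show ?case using le by (intro exI[of _ "int (degree f) * e"]) auto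
qed

section \<open>Prime power degrees\<close>

lemma prime_dvd_all_choose_imp_power:
  fixes p d :: nat
  assumes p: "prime p" and d: "d \<ge> 2" and dv: "\<And>i. 0 < i \<Longrightarrow> i < d \<Longrightarrow> p dvd d choose i"
  shows "\<exists>m\<ge>1. d = p ^ m"
proof -
  define m where "m = multiplicity p d"
  have "\<not> is_unit p" using p by auto
  then obtain e where e: "d = p ^ m * e" "\<not> p dvd e"
    using multiplicity_decompose'[of d p] d unfolding m_def by (metis not_numeral_le_zero)
  have e0: "e > 0" using e d by (cases "e = 0") auto
  have pm: "p ^ m > 0" using p by (simp add: prime_gt_0_nat)
  \<comment> \<open>The binomial coefficient of \<open>p ^ m * e\<close> over \<open>p ^ m\<close>
    has the same \<open>p\<close>-part as \<open>e\<close>, a count known from Wielandt's proof of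
    Sylow's theorem. So the index \<open>p ^ m\<close> violates \<open>dv\<close> unless it equals
    \<open>d\<close>.\<close>
  have "multiplicity p (d choose p ^ m) = multiplicity p e"
    using const_p_fac[OF e0 p, of m] e by simp
  also have "\<dots> = 0" using e by (simp add: not_dvd_imp_multiplicity_0)
  finally have "multiplicity p (d choose p ^ m) = 0" .
  moreover have "p ^ m \<le> d" using e e0 by simp
  then have "d choose p ^ m \<noteq> 0" by simp
  ultimately have "\<not> p dvd d choose p ^ m"
    using \<open>\<not> is_unit p\<close> multiplicity_eq_zero_iff by blast
  then have "\<not> p ^ m < d" using dv[of "p ^ m"] pm by blast
  then have "d = p ^ m" using \<open>p ^ m \<le> d\<close> by simp
  moreover have "m \<noteq> 0" using \<open>d = p ^ m\<close> d by (intro notI) auto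
  ultimately show ?thesis by (intro exI[of _ m]) auto
qed

lemma pcompose_monom: "pcompose (monom c n) q = smult c (q ^ n)" for q :: "'a::comm_ring_1 poly"
  by (induction n) (simp_all add: monom_Suc monom_0 pcompose_pCons)

text \<open>Undoing the shift by \<open>c\<close> presents \<open>f\<close> modulo \<open>p\<close>
  as \<open>u (x - c)^d\<close> with \<open>d\<close> the degree. Its inner coefficients are unit
  multiples of binomial coefficients, whereas those of \<open>f\<close> vanish modulo
  \<open>p\<close>.\<close>

lemma p_type_translates_imp_prime_power:
  assumes p: "prime p" and d: "degree f \<ge> 2"
    and f: "p_type p (f - [:b:])" and g: "p_type p (pcompose f [:c, 1:])" and c: "val_eq p 0 c"
  shows "\<exists>m\<ge>1. degree f = p ^ m"
proof (rule prime_dvd_all_choose_imp_power[OF p d], rule ccontr)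
  fix i assume i: "0 < i" "i < degree f" and nd: "\<not> p dvd degree f choose i"
  let ?d = "degree f"
  define F where "F = pcompose f [:c, 1:]"
  define L where "L = [:- c, 1:]"
  define u where "u = coeff F ?d"
  define R where "R = F - monom u ?d"
  have dF: "degree F = ?d" by (simp add: F_def degree_pcompose)
  have F: "first_min p 0 ?d F" using g dF by (simp add: p_type_iff_first_min F_def)
  have u: "val_eq p 0 u" using F by (simp add: first_min_def u_def)
  have R: "val_ge p 1 (coeff R k)" for k
    using F coeff_eq_0[of F k] dF
    by (cases k ?d rule: linorder_cases) (auto simp: R_def u_def first_min_def)
  have "f = pcompose F L"
    by (simp add: F_def L_def pcompose_assoc[symmetric] pcompose_pCons)
  also have "\<dots> = pcompose (monom u ?d) L + pcompose R L"
    by (simp add: R_def pcompose_diff)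
  also have "pcompose (monom u ?d) L = smult u (L ^ ?d)"
    by (rule pcompose_monom)
  finally have fi: "coeff f i = u * coeff (L ^ ?d) i + coeff (pcompose R L) i"
    by (metis coeff_add coeff_smult)
  \<comment> \<open>This gives integrality of the powers of \<open>L\<close>, so substituting
    \<open>L\<close> into \<open>R\<close> keeps the divisibility by \<open>p\<close>.\<close>
  have L: "first_min p 0 0 L"
    using c val_eq_1[OF p] by (auto simp: L_def first_min_def val_eq_def coeff_pCons split: nat.split)
  have "val_ge p 1 (coeff (pcompose R L) i)"
  proof -
    have "val_ge p (1 + 0) (coeff R k * coeff (L ^ k) i)" for k
      using first_min_power[OF p L, of k] R by (intro val_ge_mult p) (auto simp: first_min_def)
    then show ?thesis
      by (simp add: pcompose_conv_sum coeff_sum val_ge_sum[OF p])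
  qed
  moreover have "val_ge p 1 (coeff f i)"
  proof -
    have "degree (f - [:b:]) = ?d"
      using d by (intro degree_diff_const) simp
    then have "val_ge p 1 (coeff (f - [:b:]) i)"
      using f i by (simp add: p_type_iff_first_min first_min_def)
    then show ?thesis using i by (simp add: coeff_pCons split: nat.splits)
  qed
  ultimately have "val_ge p 1 (u * coeff (L ^ ?d) i)"
    using val_ge_diff[OF p] fi by fastforce
  \<comment> \<open>The same coefficient in closed form: a product of units if \<open>p\<close> does
    not divide the binomial coefficient, against the bound just found.\<close>
  moreover have "val_eq p (0 + (0 + int (?d - i) * 0)) (u * (of_nat (?d choose i) * (- c) ^ (?d - i)))"
    using val_eq_of_int[OF p, of "int (?d choose i)"] nd u c
    by (intro val_eq_mult val_eq_power p) auto
  ultimately show False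
    using i by (simp add: L_def coeff_linear_poly_power val_eq_def)
qed

section \<open>Normal form of \<open>f\<close> from two factorizations of its iterate\<close>

theorem theorem2p7:
  fixes p :: nat and f :: "rat poly"
  assumes "prime p"
    and "degree f \<noteq> 1"
    and "\<not> p_type p f"
    and "eventually_p_type p f"
  shows "\<exists>m::nat. \<exists>a b :: rat. \<exists>h :: rat poly.
           m \<ge> 1 \<and> padic_val p a = 0 \<and> padic_val p b = 0 \<and>
           degree h < p ^ m \<and> gauss_val p h \<ge> 0 \<and>
           f = monom a (p ^ m) + smult (of_nat p) h + [:b:]"
proof -
  note p = assms(1)
  obtain n0 where "n0 \<ge> 1" "p_type p (poly_iter f n0)"
    using assms(4) by (auto simp: eventually_p_type_def)
  then obtain n where n: "p_type p (poly_iter f (Suc n))"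
    by (metis Suc_diff_1 less_le_trans zero_less_one)
  \<comment> \<open>A constant polynomial equals all its iterates, so it would itself be
    \<open>p\<close>-type.\<close>
  have "degree f \<noteq> 0"
  proof
    assume "degree f = 0"
    then obtain c where "f = [:c:]" by (rule degree_eq_zeroE)
    then have "poly_iter f (Suc n) = f" by (simp add: poly_iter_Suc)
    then show False using n assms(3) by simp
  qed
  then have d: "degree f \<ge> 2" using assms(2) by simp
  let ?d = "degree f"
  have dn: "degree (poly_iter f k) > 0" for k using d by (simp add: degree_poly_iter)
  have fmn: "first_min p 0 (degree (poly_iter f (Suc n))) (poly_iter f (Suc n))"
    using n by (simp add: p_type_iff_first_min)
  define a where "a = lead_coeff f"
  define b where "b = coeff f 0"
  define y where "y = coeff (poly_iter f n) 0"
  have lead: "val_eq p 0 a"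
    unfolding a_def using fmn d
    by (intro val_eq_lead_coeff_poly_iterD[OF p, of f n]) (auto simp: first_min_def)
  have fb: "p_type p (f - [:b:])"
    using p_type_pcompose_factors(1)[OF p n[unfolded poly_iter_Suc2] dn] d lead
    by (simp add: b_def a_def)
  \<comment> \<open>The iterate has positive degree, so its constant term is divisible by
    \<open>p\<close>: the orbit of 0 returns to 0 modulo \<open>p\<close>. This excludes escape in
    \<open>b0\<close> and makes \<open>y\<close> a root of \<open>f\<close> modulo \<open>p\<close>
    in \<open>fy\<close>.\<close>
  have "val_ge p 1 (poly (poly_iter f (Suc n)) 0)"
    using fmn dn by (auto simp: first_min_def poly_0_coeff_0)
  have dfb: "degree (f - [:b:]) = ?d"
    using d by (intro degree_diff_const) simp
  have fmb: "first_min p 0 ?d (f - [:b:])" using fb dfb by (simp add: p_type_iff_first_min)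
  have coeffs: "val_ge p 1 (coeff f i)" if "0 < i" "i < ?d" for i
  proof -
    have "val_ge p 1 (coeff (f - [:b:]) i)" using fmb that by (simp add: first_min_def)
    then show ?thesis using that by (simp add: coeff_pCons split: nat.splits)
  qed
  have b0: "val_ge p 0 b"
  proof (rule ccontr)
    assume nb: "\<not> val_ge p 0 b"
    then have "b \<noteq> 0" by auto
    then obtain c where c: "val_eq p c b" using val_eq_exists by blast
    then have "c < 0" using nb val_ge_mono[of p c b 0] by (metis not_le val_eq_def)
    then obtain e where "e \<le> c" "val_eq p e (poly (poly_iter f (Suc n)) 0)"
      using poly_iter_escape[OF p fb d c b_def, of n] by blast
    then show False
      using \<open>val_ge p 1 (poly (poly_iter f (Suc n)) 0)\<close> \<open>c < 0\<close>
        val_ge_mono[of p 1 _ "e + 1"] by (auto simp: val_eq_def)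
  qed
  have b: "val_eq p 0 b"
  proof (rule ccontr)
    assume "\<not> val_eq p 0 b"
    then have "val_ge p 1 b" using b0 by (simp add: val_eq_def)
    then have "\<forall>i<?d. val_ge p 1 (coeff f i)" using coeffs by (metis b_def gr0I)
    then have "p_type p f"
      using lead by (simp add: p_type_def val_ge_def one_extended_def zero_extended_def
          padic_val_eq_iff a_def)
    then show False using assms(3) by simp
  qed
  have f_int: "val_ge p 0 (coeff f i)" for i
    using coeffs[of i] b0 lead coeff_eq_0[of f i] val_ge_mono[of p 1 _ 0]
    by (cases "i = 0"; cases i ?d rule: linorder_cases) (auto simp: b_def a_def val_eq_def)
  have "val_ge p 0 (poly (poly_iter f k) 0)" for k
  proof (induction k)
    case 0
    show ?case by (simp add: poly_iter_def)
  next
    case (Suc k)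
    then show ?case by (simp add: poly_poly_iter_Suc val_ge_poly[OF p f_int])
  qed
  then have y0: "val_ge p 0 y" by (simp add: y_def poly_0_coeff_0)
  have fy: "val_ge p 1 (poly f y)"
    using \<open>val_ge p 1 (poly (poly_iter f (Suc n)) 0)\<close>
    by (metis poly_poly_iter_Suc poly_0_coeff_0 y_def)
  have y: "val_eq p 0 y"
  proof (rule ccontr)
    assume "\<not> val_eq p 0 y"
    then have y1: "val_ge p 1 y" using y0 by (simp add: val_eq_def)
    \<comment> \<open>Splitting off the constant term gives \<open>f(y) = b + y * g(y)\<close>;
      dividing both \<open>y\<close> and \<open>f(y)\<close>, \<open>p\<close> would divide the unit
      \<open>b\<close>.\<close>
    obtain g where g: "f = pCons b g" unfolding b_def by (metis coeff_pCons_0 pCons_cases)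
    then have "val_ge p 0 (coeff g i)" for i using f_int[of "Suc i"] by simp
    then have "val_ge p (1 + 0) (y * poly g y)"
      using y0 y1 by (intro val_ge_mult val_ge_poly p)
    then have "val_ge p 1 b" using val_ge_diff[OF p fy, of "y * poly g y"] g by simp
    then show False using b by (simp add: val_eq_def)
  qed
  \<comment> \<open>Required of the inner polynomial by \<open>p_type_pcompose_factors\<close>.
    Comparing leading coefficients in \<open>f\<close> composed with this iterate gives
    \<open>?d * e = 0\<close> for its valuation \<open>e\<close>.\<close>
  have "val_eq p 0 (lead_coeff (poly_iter f n))"
  proof -
    have "lead_coeff (poly_iter f (Suc n)) = a * lead_coeff (poly_iter f n) ^ ?d"
      using dn by (simp add: poly_iter_Suc lead_coeff_comp a_def)
    moreover obtain e where e: "val_eq p e (lead_coeff (poly_iter f n))"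
      using dn[of n] val_eq_exists by (metis degree_0 leading_coeff_0_iff less_irrefl)
    ultimately have "val_eq p (0 + int ?d * e) (lead_coeff (poly_iter f (Suc n)))"
      using val_eq_mult[OF p lead val_eq_power[OF p e]] by simp
    then have "0 + int ?d * e = 0" using fmn val_eq_unique unfolding first_min_def by blast
    then have "e = 0" using d by auto
    then show ?thesis using e by simp
  qed
  then have "p_type p (pcompose f [:y, 1:])"
    using p_type_pcompose_factors(2)[OF p n[unfolded poly_iter_Suc] _ dn] d by (simp add: y_def)
  then obtain m where m: "m \<ge> 1" "?d = p ^ m"
    using p_type_translates_imp_prime_power[OF p d fb _ y] by blast
  \<comment> \<open>Removing the leading and constant terms leaves the coefficients covered by
    \<open>coeffs\<close>; their valuation of at least 1 makes up for the division by
    \<open>p\<close>.\<close>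
  define h where "h = smult (inverse (of_nat p)) (f - monom a ?d - [:b:])"
  have p0: "(of_nat p :: rat) \<noteq> 0" using p by auto
  have f_eq: "f = monom a ?d + smult (of_nat p) h + [:b:]"
    using p0 by (simp add: h_def)
  have ch: "coeff h i = (if 0 < i \<and> i < ?d then inverse (of_nat p) * coeff f i else 0)" for i
    using d coeff_eq_0[of f i]
    by (cases i ?d rule: linorder_cases) (auto simp: h_def a_def b_def coeff_pCons split: nat.split)
  have "val_eq p (-1) (inverse (of_nat p))"
    using padic_val_fraction[OF p, of 1 "int p"] p
    by (auto simp: padic_val_eq_iff[symmetric] inverse_eq_divide)
  then have "val_ge p 0 (coeff h i)" for i
    using val_ge_mult[OF p, of "-1" "inverse (of_nat p)" 1 "coeff f i"] coeffs[of i]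
    by (auto simp: ch val_eq_def)
  then have "gauss_val p h \<ge> 0"
    unfolding zero_extended_def gauss_val_ge_iff by simp
  moreover have "degree h < ?d"
    using d by (intro degree_lessI) (auto simp: ch)
  ultimately show ?thesis
    using m f_eq lead b
    by (intro exI[of _ m] exI[of _ a] exI[of _ b] exI[of _ h])
      (simp add: zero_extended_def padic_val_eq_iff)
qed

end
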